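(* Let $(\Omega,\mathcal F,\mathbb P)$ be a standard probability space, $\theta:\Omega\to\Omega$ an invertible, bimeasurable, measure-preserving transformation, $H$ a real separable Hilbert space, and $\mathscr H=L^2(\Omega;H)$. Let $S\subset\mathbb Z$ be finite and $F_S=\{0\}\cup S\cup(S+S)$. Assume $\mathbb P\{\omega:\theta^a\omega=\theta^b\omega\}=0$ for all $a\neq b$ in $F_S$. Then every continuous proximity operator $T$ on $\mathscr H$ that admits a finite $S$-memory representation satisfies $$\operatorname{Act}(T)=-\operatorname{Act}(T).$$ Consequently, if $S\cap(-S)\subset\{0\}$, all nonzero lags $k\in S$ are inactive.
   Context: A map $T:\mathscr H\to\mathscr H$ is a continuous proximity operator if $T$ is continuous and there is a proper (not identically $+\infty$), possibly nonconvex, penalty $\phi:\mathscr H\to\mathbb R\cup\{+\infty\}$ such that $T(x)\in\arg\min_y\{\tfrac12\|x-y\|^2+\phi(y)\}$ for all $x\in\mathscr H$. A finite $S$-memory representation of a continuous $T$ is a Carathéodory representation $(Tu)(\omega)=t_\omega\bigl((u(\theta^s\omega))_{s\in S}\bigr)$ (a.e. $\omega$, for every $u\in\mathscr H$), where $t_\omega:H^S\to H$ is continuous for a.e. $\omega$ and $\omega\mapsto t_\omega(z)$ is measurable for each fixed $z\in H^S$. For $k\in S$, the $k$th lag is inactive if, outside one null set of $\omega$, $t_\omega$ is independent of its $k$th coordinate; otherwise active. $\operatorname{Act}(T)=\{k\in S:k\text{ is active}\}$, $-\operatorname{Act}(T)=\{-k:k\in\operatorname{Act}(T)\}$, and $S+S=\{s+t:s,t\in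 S\}$. *)

theory Defs
  imports "HOL-Probability.Probability"
begin

definition standard_borel :: "'a measure \<Rightarrow> bool" where
  "standard_borel N \<longleftrightarrow>
     (\<exists>X. completely_metrizable_space X \<and> second_countable X \<and> topspace X = space N \<and>
          sets N = sigma_sets (space N) {U. openin X U})"

text \<open>
  Both conventions in use are admitted: a standard Borel space with a probability measure, and
  (Lebesgue--Rokhlin) the completion of such a space; in either case only up to a null set.
\<close>

definition standard_prob_space :: "'a measure \<Rightarrow> bool" where
  "standard_prob_space M \<longleftrightarrow>
     prob_space M \<and>
     (\<exists>\<Omega>\<^sub>0 \<in> sets M. measure M \<Omega>\<^sub>0 = 1 \<and>
        (\<exists>N. standard_borel N \<and>
             (restrict_space M \<Omega>\<^sub>0 = N \<or> restrict_space M \<Omega>\<^sub>0 = completion N)))"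

definition invertible_mpt :: "'a measure \<Rightarrow> ('a \<Rightarrow> 'a) \<Rightarrow> bool" where
  "invertible_mpt M \<theta> \<longleftrightarrow>
     bij_betw \<theta> (space M) (space M) \<and>
     \<theta> \<in> measurable M M \<and> inv_into (space M) \<theta> \<in> measurable M M \<and>
     distr M M \<theta> = M"

definition iter :: "'a measure \<Rightarrow> ('a \<Rightarrow> 'a) \<Rightarrow> int \<Rightarrow> 'a \<Rightarrow> 'a" where
  "iter M \<theta> k = (if 0 \<le> k then \<theta> ^^ nat k else inv_into (space M) \<theta> ^^ nat (- k))"

text \<open>
  Elements of \<open>L\<^sup>2(\<Omega>; H)\<close> are represented by square-integrable functions. Maps and penalties
  on \<open>L\<^sup>2(\<Omega>; H)\<close> are represented by maps and penalties on these functions that respect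
  equality almost everywhere.
\<close>

definition L2 :: "'a measure \<Rightarrow> ('a \<Rightarrow> 'h::{real_inner, banach, second_countable_topology}) set" where
  "L2 M = {u \<in> borel_measurable M. integrable M (\<lambda>\<omega>. (norm (u \<omega>))\<^sup>2)}"

definition L2_norm :: "'a measure \<Rightarrow> ('a \<Rightarrow> 'h::{real_inner, banach, second_countable_topology}) \<Rightarrow> real" where
  "L2_norm M u = sqrt (\<integral>\<omega>. (norm (u \<omega>))\<^sup>2 \<partial>M)"

definition L2_map ::
  "'a measure \<Rightarrow> (('a \<Rightarrow> 'h) \<Rightarrow> 'a \<Rightarrow> 'h::{real_inner, banach, second_countable_topology}) \<Rightarrow> bool" where
  "L2_map M T \<longleftrightarrow>
     (\<forall>u \<in> L2 M. T u \<in> L2 M) \<and>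
     (\<forall>u \<in> L2 M. \<forall>v \<in> L2 M. (AE \<omega> in M. u \<omega> = v \<omega>) \<longrightarrow> (AE \<omega> in M. T u \<omega> = T v \<omega>))"

definition L2_continuous ::
  "'a measure \<Rightarrow> (('a \<Rightarrow> 'h) \<Rightarrow> 'a \<Rightarrow> 'h::{real_inner, banach, second_countable_topology}) \<Rightarrow> bool" where
  "L2_continuous M T \<longleftrightarrow>
     (\<forall>u \<in> L2 M. \<forall>\<epsilon>>0. \<exists>\<delta>>0. \<forall>v \<in> L2 M.
        L2_norm M (\<lambda>\<omega>. v \<omega> - u \<omega>) < \<delta> \<longrightarrow> L2_norm M (\<lambda>\<omega>. T v \<omega> - T u \<omega>) < \<epsilon>)"

definition proper_penalty ::
  "'a measure \<Rightarrow> (('a \<Rightarrow> 'h::{real_inner, banach, second_countable_topology}) \<Rightarrow> ereal) \<Rightarrow> bool" where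
  "proper_penalty M \<phi> \<longleftrightarrow>
     (\<forall>u \<in> L2 M. \<forall>v \<in> L2 M. (AE \<omega> in M. u \<omega> = v \<omega>) \<longrightarrow> \<phi> u = \<phi> v) \<and>
     (\<forall>u \<in> L2 M. \<phi> u \<noteq> -\<infinity>) \<and>
     (\<exists>u \<in> L2 M. \<phi> u \<noteq> \<infinity>)"

definition continuous_prox ::
  "'a measure \<Rightarrow> (('a \<Rightarrow> 'h) \<Rightarrow> 'a \<Rightarrow> 'h::{real_inner, banach, second_countable_topology}) \<Rightarrow> bool" where
  "continuous_prox M T \<longleftrightarrow>
     L2_map M T \<and> L2_continuous M T \<and>
     (\<exists>\<phi>. proper_penalty M \<phi> \<and>
        (\<forall>x \<in> L2 M.
           is_arg_min (\<lambda>y. ereal (1 / 2 * (L2_norm M (\<lambda>\<omega>. x \<omega> - y \<omega>))\<^sup>2) + \<phi> y)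
             (\<lambda>y. y \<in> L2 M) (T x)))"

text \<open>
  A point of \<open>H\<^sup>S\<close> is an extensional function in \<open>PiE S (\<lambda>_. UNIV)\<close>.
\<close>

definition memory_representation ::
  "'a measure \<Rightarrow> ('a \<Rightarrow> 'a) \<Rightarrow> int set \<Rightarrow>
   (('a \<Rightarrow> 'h) \<Rightarrow> 'a \<Rightarrow> 'h::{real_inner, banach, second_countable_topology}) \<Rightarrow>
   ('a \<Rightarrow> (int \<Rightarrow> 'h) \<Rightarrow> 'h) \<Rightarrow> bool" where
  "memory_representation M \<theta> S T t \<longleftrightarrow>
     (AE \<omega> in M. continuous_map (product_topology (\<lambda>_. euclidean) S) euclidean (t \<omega>)) \<and>
     (\<forall>z \<in> PiE S (\<lambda>_. UNIV). (\<lambda>\<omega>. t \<omega> z) \<in> borel_measurable M) \<and>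
     (\<forall>u \<in> L2 M. AE \<omega> in M. T u \<omega> = t \<omega> (\<lambda>s\<in>S. u (iter M \<theta> s \<omega>)))"

definition lag_inactive ::
  "'a measure \<Rightarrow> int set \<Rightarrow> ('a \<Rightarrow> (int \<Rightarrow> 'h) \<Rightarrow> 'h) \<Rightarrow> int \<Rightarrow> bool" where
  "lag_inactive M S t k \<longleftrightarrow>
     (AE \<omega> in M. \<forall>z \<in> PiE S (\<lambda>_. UNIV). \<forall>h. t \<omega> (z(k := h)) = t \<omega> z)"

text \<open>
  \<open>Act\<close> is taken relative to a representation; it depends only on the map represented as soon
  as the iterates with exponents in \<open>S\<close> are pairwise almost everywhere distinct on a
  standard space, since the representation is then unique up to a null set.
\<close>

definition Act :: "'a measure \<Rightarrow> int set \<Rightarrow> ('a \<Rightarrow> (int \<Rightarrow> 'h) \<Rightarrow> 'h) \<Rightarrow> int set" where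
  "Act M S t = {k \<in> S. \<not> lag_inactive M S t k}"

end

theory Submission
  imports Defs
begin

text \<open>
  The identity is the symmetry of second derivatives in disguise. A proximity operator is a selection
  of subgradients of a convex function: with \<open>\<psi> x = \<langle>x, T x\<rangle> - \<parallel>T x\<parallel>\<^sup>2/2 - \<phi> (T x)\<close>, minimality of \<open>T y\<close>
  against the competitor \<open>T x\<close> reads \<open>\<psi> y - \<psi> x \<ge> \<langle>T x, y - x\<rangle>\<close>
  (\<open>continuous_prox_subgradient\<close>). If \<open>T\<close> is continuous, then \<open>\<psi>\<close> is differentiable along
  lines with gradient \<open>T\<close>, so the influence of a direction \<open>v\<close> on \<open>\<langle>T u, g\<rangle>\<close> mirrors the
  influence of \<open>g\<close> on \<open>\<langle>T u, v\<rangle>\<close>. Since \<open>T\<close> itself need not be differentiable, this is used in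
  the following form: if moving along \<open>g\<close> never changes \<open>\<langle>T u, v\<rangle>\<close>, then moving along \<open>v\<close> does not
  change \<open>\<langle>T u, g\<rangle>\<close> (\<open>continuous_prox_reciprocity\<close>), because the restriction of \<open>\<psi>\<close> to the plane
  through \<open>u\<close> spanned by \<open>g\<close> and \<open>v\<close> is then a sum of two functions of one variable.

  Let \<open>A\<close> be a set whose translates \<open>\<theta>\<^sup>a A\<close>, for \<open>a\<close> in \<open>{0} \<union> S \<union> (S + S)\<close>, are pairwise disjoint. The
  output on \<open>A\<close> sees an input perturbation supported on \<open>\<theta>\<^sup>k A\<close> through lag \<open>k\<close> only, and the
  output on \<open>\<theta>\<^sup>k A\<close> sees a perturbation supported on \<open>A\<close> through lag \<open>-k\<close> only. If lag \<open>-k\<close> is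
  absent or inactive, the second influence vanishes, hence so does the first
  (\<open>translate_perturbation_invisible\<close>). Inputs that are constant on each translate \<open>\<theta>\<^sup>s A\<close> turn this
  into \<open>t \<omega> (z(k := h)) = t \<omega> z\<close> for almost every \<open>\<omega> \<in> A\<close> and each fixed \<open>z\<close> and \<open>h\<close>
  (\<open>representation_blind_at_constants\<close>).
  As \<open>\<Omega>\<close> is standard and the iterates in question are almost everywhere distinct, countably many such sets
  \<open>A\<close> cover almost everything (\<open>countable_cover_disjoint_translates\<close>). Letting \<open>z\<close> and \<open>h\<close> range over a
  countable dense set and using continuity of \<open>t \<omega>\<close>, one null set serves all arguments, so lag \<open>k\<close>
  is inactive. By contraposition \<open>Act\<close> is closed under negation.
\<close>
section \<open>Subgradient fields on the line and on the plane\<close>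

text \<open>
  The subgradient inequality, read at both endpoints, squeezes the difference quotient between
  \<open>p x\<close> and \<open>p y\<close>.
\<close>
lemma DERIV_of_continuous_subgradient:
  fixes f p :: "real \<Rightarrow> real"
  assumes sub: "\<And>x y. (y - x) * p x \<le> f y - f x" and cont: "isCont p x"
  shows "(f has_real_derivative p x) (at x)"
proof -
  have bound: "\<bar>(f y - f x) / (y - x) - p x\<bar> \<le> \<bar>p y - p x\<bar>" if "y \<noteq> x" for y
  proof -
    have lo: "(y - x) * p x \<le> f y - f x" using sub[of y x] .
    have hi: "f y - f x \<le> (y - x) * p y" using sub[of x y] by (simp add: algebra_simps)
    show ?thesis
    proof (cases "y > x")
      case True
      then have "p x \<le> (f y - f x) / (y - x)" "(f y - f x) / (y - x) \<le> p y"
        using lo hi by (simp_all add: field_simps)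
      then show ?thesis by linarith
    next
      case False
      with that have "y < x" by simp
      then have "(f y - f x) / (y - x) \<le> p x" "p y \<le> (f y - f x) / (y - x)"
        using lo hi by (simp_all add: field_simps)
      then show ?thesis by linarith
    qed
  qed
  have "(\<lambda>y. \<bar>p y - p x\<bar>) \<midarrow>x\<rightarrow> 0"
    using cont by (simp add: isCont_def LIM_zero tendsto_rabs_zero)
  then have "(\<lambda>y. (f y - f x) / (y - x) - p x) \<midarrow>x\<rightarrow> 0"
    by (rule Lim_null_comparison[rotated]) (auto simp: eventually_at_filter bound)
  then show ?thesis
    by (simp add: has_field_derivative_iff LIM_zero_cancel)
qed

text \<open>
  As \<open>Q\<close> does not depend on \<open>\<sigma>\<close>, the difference of any two sections \<open>F \<rho>\<close> and \<open>F \<sigma>\<close> has derivative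
  zero; so \<open>F\<close> splits into a function of the first variable plus one of the second, and the first
  partial derivative cannot depend on the second variable. This replaces the symmetry of the Hessian
  when \<open>F\<close> is only once differentiable.
\<close>
lemma cross_independence_of_subgradients:
  fixes F P :: "real \<Rightarrow> real \<Rightarrow> real" and Q :: "real \<Rightarrow> real"
  assumes sub: "\<And>\<sigma> \<tau> \<sigma>' \<tau>'. (\<sigma>' - \<sigma>) * P \<sigma> \<tau> + (\<tau>' - \<tau>) * Q \<tau> \<le> F \<sigma>' \<tau>' - F \<sigma> \<tau>"
    and contP: "\<And>\<sigma> \<tau>. isCont (\<lambda>\<sigma>. P \<sigma> \<tau>) \<sigma>"
    and contQ: "\<And>\<tau>. isCont Q \<tau>"
  shows "P \<sigma> \<tau> = P \<sigma> \<tau>'"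
proof -
  have dP: "((\<lambda>\<sigma>. F \<sigma> \<tau>) has_real_derivative P \<sigma> \<tau>) (at \<sigma>)" for \<sigma> \<tau>
    using sub[of _ _ \<tau> \<tau>] contP by (intro DERIV_of_continuous_subgradient) auto
  have dQ: "((\<lambda>\<tau>. F \<sigma> \<tau>) has_real_derivative Q \<tau>) (at \<tau>)" for \<sigma> \<tau>
    using sub[of \<sigma> \<sigma>] contQ by (intro DERIV_of_continuous_subgradient) auto
  have "((\<lambda>\<tau>. F \<rho> \<tau> - F \<sigma> \<tau>) has_real_derivative 0) (at \<tau>)" for \<rho> \<tau>
    using DERIV_diff[OF dQ[of \<rho> \<tau>] dQ[of \<sigma> \<tau>]] by simp
  then have "F \<rho> \<tau> - F \<sigma> \<tau> = F \<rho> \<tau>' - F \<sigma> \<tau>'" for \<rho>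
    by (intro DERIV_isconst_all) auto
  then have eq: "(\<lambda>\<rho>. F \<rho> \<tau>) = (\<lambda>\<rho>. F \<rho> \<tau>' + (F \<sigma> \<tau> - F \<sigma> \<tau>'))"
    by (auto simp: fun_eq_iff algebra_simps)
  have "((\<lambda>\<rho>. F \<rho> \<tau>) has_real_derivative P \<sigma> \<tau>') (at \<sigma>)"
    unfolding eq by (auto intro!: derivative_eq_intros dP)
  with dP show ?thesis by (rule DERIV_unique)
qed

section \<open>Square-integrable functions\<close>

lemma L2_add:
  assumes "u \<in> L2 M" "v \<in> L2 M"
  shows "(\<lambda>\<omega>. u \<omega> + v \<omega>) \<in> L2 M"
proof -
  have [measurable]: "u \<in> borel_measurable M" "v \<in> borel_measurable M"
    using assms by (auto simp: L2_def)
  have "integrable M (\<lambda>\<omega>. (norm (u \<omega> + v \<omega>))\<^sup>2)"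
  proof (rule Bochner_Integration.integrable_bound)
    show "integrable M (\<lambda>\<omega>. 2 * (norm (u \<omega>))\<^sup>2 + 2 * (norm (v \<omega>))\<^sup>2)"
      using assms by (auto simp: L2_def)
    have "(norm (a + b))\<^sup>2 \<le> 2 * (norm a)\<^sup>2 + 2 * (norm b)\<^sup>2" for a b :: 'b
    proof -
      have "0 \<le> (norm (a - b))\<^sup>2" by simp
      then show ?thesis
        by (simp add: power2_norm_eq_inner inner_simps inner_commute)
    qed
    then show "AE \<omega> in M. norm ((norm (u \<omega> + v \<omega>))\<^sup>2)
        \<le> norm (2 * (norm (u \<omega>))\<^sup>2 + 2 * (norm (v \<omega>))\<^sup>2)"
      by simp
  qed simp
  then show ?thesis by (simp add: L2_def)
qed

lemma L2_scaleR: "u \<in> L2 M \<Longrightarrow> (\<lambda>\<omega>. c *\<^sub>R u \<omega>) \<in> L2 M"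
  by (auto simp: L2_def power_mult_distrib)

lemma L2_diff:
  assumes "u \<in> L2 M" "v \<in> L2 M"
  shows "(\<lambda>\<omega>. u \<omega> - v \<omega>) \<in> L2 M"
  using L2_add[OF assms(1) L2_scaleR[OF assms(2), of "-1"]] by simp

lemma L2_restrict:
  assumes "u \<in> L2 M" "A \<in> sets M"
  shows "(\<lambda>\<omega>. indicator A \<omega> *\<^sub>R u \<omega>) \<in> L2 M"
proof -
  have [measurable]: "u \<in> borel_measurable M" "A \<in> sets M"
    using assms by (auto simp: L2_def)
  have "integrable M (\<lambda>\<omega>. (norm (indicator A \<omega> *\<^sub>R u \<omega>))\<^sup>2)"
  proof (rule Bochner_Integration.integrable_bound)
    show "integrable M (\<lambda>\<omega>. (norm (u \<omega>))\<^sup>2)" using assms by (simp add: L2_def)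
  qed (auto simp: indicator_def)
  then show ?thesis by (simp add: L2_def)
qed

lemma L2_inner_integrable:
  assumes "u \<in> L2 M" "v \<in> L2 M"
  shows "integrable M (\<lambda>\<omega>. u \<omega> \<bullet> v \<omega>)"
proof -
  have "integrable M (\<lambda>\<omega>. ((norm (u \<omega> + v \<omega>))\<^sup>2 - (norm (u \<omega>))\<^sup>2 - (norm (v \<omega>))\<^sup>2) / 2)"
    using assms L2_add[OF assms] by (auto simp: L2_def)
  moreover have "((norm (a + b))\<^sup>2 - (norm a)\<^sup>2 - (norm b)\<^sup>2) / 2 = a \<bullet> b" for a b :: 'b
    by (simp add: power2_norm_eq_inner inner_simps inner_commute)
  ultimately show ?thesis by simp
qed

lemma L2_norm_sq: "(L2_norm M u)\<^sup>2 = (\<integral>\<omega>. (norm (u \<omega>))\<^sup>2 \<partial>M)"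
  by (simp add: L2_norm_def)

lemma L2_norm_nonneg: "0 \<le> L2_norm M u"
  by (simp add: L2_norm_def)

lemma L2_norm_scaleR: "L2_norm M (\<lambda>\<omega>. c *\<^sub>R u \<omega>) = \<bar>c\<bar> * L2_norm M u"
  by (simp add: L2_norm_def power_mult_distrib real_sqrt_mult)

lemma L2_norm_sq_diff:
  assumes "u \<in> L2 M" "v \<in> L2 M"
  shows "(L2_norm M (\<lambda>\<omega>. u \<omega> - v \<omega>))\<^sup>2
    = (L2_norm M u)\<^sup>2 - 2 * (\<integral>\<omega>. u \<omega> \<bullet> v \<omega> \<partial>M) + (L2_norm M v)\<^sup>2"
proof -
  have "(norm (a - b))\<^sup>2 = (norm a)\<^sup>2 - 2 * (a \<bullet> b) + (norm b)\<^sup>2" for a b :: 'b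
    by (simp add: power2_norm_eq_inner inner_simps inner_commute)
  then show ?thesis
    using assms L2_inner_integrable[OF assms] by (simp add: L2_norm_sq L2_def)
qed

lemma nonneg_quadratic_imp_discriminant_le:
  fixes a b d :: real
  assumes nonneg: "\<And>c. 0 \<le> a - 2 * c * b + c\<^sup>2 * d" and "0 \<le> d"
  shows "b\<^sup>2 \<le> a * d"
proof (cases "d = 0")
  case True
  have "b = 0"
  proof (rule ccontr)
    assume "b \<noteq> 0"
    then show False
      \<comment> \<open>At this point the affine function \<open>a - 2 * c * b\<close> of \<open>c\<close> takes the value \<open>-1\<close>.\<close>
      using nonneg[of "(a + 1) / (2 * b)"] True by simp
  qed
  with True show ?thesis by simp
next
  case False
  with \<open>0 \<le> d\<close> have "0 < d" by simp
  then show ?thesis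
    \<comment> \<open>The minimiser of the quadratic.\<close>
    using nonneg[of "b / d"] by (simp add: field_simps power2_eq_square)
qed

lemma L2_Cauchy_Schwarz:
  assumes "u \<in> L2 M" "v \<in> L2 M"
  shows "\<bar>\<integral>\<omega>. u \<omega> \<bullet> v \<omega> \<partial>M\<bar> \<le> L2_norm M u * L2_norm M v"
proof -
  have "0 \<le> (L2_norm M u)\<^sup>2 - 2 * c * (\<integral>\<omega>. u \<omega> \<bullet> v \<omega> \<partial>M) + c\<^sup>2 * (L2_norm M v)\<^sup>2" for c
  proof -
    have "0 \<le> (L2_norm M (\<lambda>\<omega>. u \<omega> - c *\<^sub>R v \<omega>))\<^sup>2" by simp
    also have "\<dots> = (L2_norm M u)\<^sup>2 - 2 * c * (\<integral>\<omega>. u \<omega> \<bullet> v \<omega> \<partial>M) + c\<^sup>2 * (L2_norm M v)\<^sup>2"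
      using L2_norm_sq_diff[OF assms(1) L2_scaleR[OF assms(2)], of c]
      by (simp add: L2_norm_scaleR power_mult_distrib)
    finally show ?thesis .
  qed
  then have "(\<integral>\<omega>. u \<omega> \<bullet> v \<omega> \<partial>M)\<^sup>2 \<le> (L2_norm M u)\<^sup>2 * (L2_norm M v)\<^sup>2"
    by (rule nonneg_quadratic_imp_discriminant_le) simp
  then show ?thesis
    using abs_le_square_iff[of "\<integral>\<omega>. u \<omega> \<bullet> v \<omega> \<partial>M" "L2_norm M u * L2_norm M v"]
      L2_norm_nonneg[of M u] L2_norm_nonneg[of M v]
    by (simp add: power_mult_distrib)
qed

lemma isCont_L2_inner_along_line:
  assumes T: "L2_map M T" "L2_continuous M T" and u: "u \<in> L2 M" "g \<in> L2 M" and w: "w \<in> L2 M"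
  shows "isCont (\<lambda>c. \<integral>\<omega>. T (\<lambda>\<omega>. u \<omega> + c *\<^sub>R g \<omega>) \<omega> \<bullet> w \<omega> \<partial>M) c"
  unfolding continuous_at_eps_delta
proof (intro allI impI)
  fix e :: real assume e: "0 < e"
  define x where "x c \<omega> = u \<omega> + c *\<^sub>R g \<omega>" for c \<omega>
  have x: "x c \<in> L2 M" for c
    unfolding x_def using L2_add[OF u(1) L2_scaleR[OF u(2)]] .
  then have Tx: "T (x c) \<in> L2 M" for c
    using T by (simp add: L2_map_def)
  \<comment> \<open>The summand \<open>1\<close> in both denominators keeps them positive when \<open>w\<close> or \<open>g\<close> vanishes.\<close>
  define e' where "e' = e / (L2_norm M w + 1)"
  have "0 < e'" using e L2_norm_nonneg[of M w] by (simp add: e'_def)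
  then obtain d where d: "0 < d"
    "\<And>v. v \<in> L2 M \<Longrightarrow> L2_norm M (\<lambda>\<omega>. v \<omega> - x c \<omega>) < d \<Longrightarrow> L2_norm M (\<lambda>\<omega>. T v \<omega> - T (x c) \<omega>) < e'"
    using T(2) x[of c] unfolding L2_continuous_def by meson
  define d' where "d' = d / (L2_norm M g + 1)"
  have "0 < d'" using d(1) L2_norm_nonneg[of M g] by (simp add: d'_def)
  moreover have "dist (\<integral>\<omega>. T (x b) \<omega> \<bullet> w \<omega> \<partial>M) (\<integral>\<omega>. T (x c) \<omega> \<bullet> w \<omega> \<partial>M) < e"
    if b: "dist b c < d'" for b
  proof -
    have "(\<lambda>\<omega>. x b \<omega> - x c \<omega>) = (\<lambda>\<omega>. (b - c) *\<^sub>R g \<omega>)"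
      by (simp add: x_def scaleR_left_diff_distrib)
    then have "L2_norm M (\<lambda>\<omega>. x b \<omega> - x c \<omega>) = \<bar>b - c\<bar> * L2_norm M g"
      by (simp add: L2_norm_scaleR)
    also have "\<dots> \<le> d' * L2_norm M g"
      using b L2_norm_nonneg[of M g] by (intro mult_right_mono) (auto simp: dist_real_def)
    also have "\<dots> < d"
      using d(1) L2_norm_nonneg[of M g] by (simp add: d'_def field_simps)
    finally have small: "L2_norm M (\<lambda>\<omega>. T (x b) \<omega> - T (x c) \<omega>) < e'"
      using d(2) x by blast
    have "dist (\<integral>\<omega>. T (x b) \<omega> \<bullet> w \<omega> \<partial>M) (\<integral>\<omega>. T (x c) \<omega> \<bullet> w \<omega> \<partial>M)
        = \<bar>\<integral>\<omega>. (T (x b) \<omega> - T (x c) \<omega>) \<bullet> w \<omega> \<partial>M\<bar>"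
      using L2_inner_integrable[OF Tx w] by (simp add: dist_real_def inner_diff_left)
    also have "\<dots> \<le> L2_norm M (\<lambda>\<omega>. T (x b) \<omega> - T (x c) \<omega>) * L2_norm M w"
      by (intro L2_Cauchy_Schwarz L2_diff Tx w)
    also have "\<dots> \<le> e' * L2_norm M w"
      using small L2_norm_nonneg[of M w] by (intro mult_right_mono) auto
    also have "\<dots> < e"
      using e L2_norm_nonneg[of M w] by (simp add: e'_def field_simps)
    finally show ?thesis .
  qed
  ultimately show "\<exists>d'>0. \<forall>b. dist b c < d' \<longrightarrow>
      dist (\<integral>\<omega>. T (\<lambda>\<omega>. u \<omega> + b *\<^sub>R g \<omega>) \<omega> \<bullet> w \<omega> \<partial>M)
        (\<integral>\<omega>. T (\<lambda>\<omega>. u \<omega> + c *\<^sub>R g \<omega>) \<omega> \<bullet> w \<omega> \<partial>M) < e"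
    unfolding x_def by blast
qed

section \<open>Reciprocity for proximity operators\<close>

text \<open>
  Minimality of \<open>T y\<close> in the problem at \<open>y\<close>, tested with \<open>T x\<close>, becomes a subgradient inequality once
  the squares are expanded: the \<open>\<parallel>y\<parallel>\<^sup>2\<close> terms cancel, so each competitor contributes a function that is
  affine in \<open>y\<close>, and the potential is the upper envelope of these functions over the range of \<open>T\<close>. The penalty
  is finite along \<open>T\<close> because a proper penalty offers a competitor of finite cost, so the
  potential is real-valued.
\<close>
lemma continuous_prox_subgradient:
  assumes "continuous_prox M T"
  obtains \<psi> where "\<And>x y. x \<in> L2 M \<Longrightarrow> y \<in> L2 M \<Longrightarrow>
    (\<integral>\<omega>. T x \<omega> \<bullet> (y \<omega> - x \<omega>) \<partial>M) \<le> \<psi> y - \<psi> x"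
proof -
  obtain \<phi> where map: "L2_map M T" and proper: "proper_penalty M \<phi>"
    and min: "\<And>x. x \<in> L2 M \<Longrightarrow>
      is_arg_min (\<lambda>y. ereal (1 / 2 * (L2_norm M (\<lambda>\<omega>. x \<omega> - y \<omega>))\<^sup>2) + \<phi> y) (\<lambda>y. y \<in> L2 M) (T x)"
    using assms unfolding continuous_prox_def by blast
  have TL: "T x \<in> L2 M" if "x \<in> L2 M" for x
    using map that by (simp add: L2_map_def)
  have le: "ereal (1 / 2 * (L2_norm M (\<lambda>\<omega>. x \<omega> - T x \<omega>))\<^sup>2) + \<phi> (T x)
      \<le> ereal (1 / 2 * (L2_norm M (\<lambda>\<omega>. x \<omega> - y \<omega>))\<^sup>2) + \<phi> y"
    if "x \<in> L2 M" "y \<in> L2 M" for x y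
    using min[OF that(1)] that(2) by (auto simp: is_arg_min_def not_less)
  have "\<exists>r. \<phi> (T x) = ereal r" if x: "x \<in> L2 M" for x
  proof -
    obtain y where y: "y \<in> L2 M" "\<phi> y \<noteq> \<infinity>"
      using proper unfolding proper_penalty_def by blast
    then have "\<phi> (T x) \<noteq> \<infinity>" using le[OF x y(1)] by (cases "\<phi> y") auto
    moreover have "\<phi> (T x) \<noteq> -\<infinity>" using proper TL[OF x] unfolding proper_penalty_def by blast
    ultimately show ?thesis by (cases "\<phi> (T x)") auto
  qed
  then obtain p where p: "\<And>x. x \<in> L2 M \<Longrightarrow> \<phi> (T x) = ereal (p x)" by metis
  define \<psi> where "\<psi> x = (\<integral>\<omega>. x \<omega> \<bullet> T x \<omega> \<partial>M) - 1 / 2 * (L2_norm M (T x))\<^sup>2 - p x" for x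
  have "(\<integral>\<omega>. T x \<omega> \<bullet> (y \<omega> - x \<omega>) \<partial>M) \<le> \<psi> y - \<psi> x" if x: "x \<in> L2 M" and y: "y \<in> L2 M" for x y
  proof -
    have "1 / 2 * (L2_norm M (\<lambda>\<omega>. y \<omega> - T y \<omega>))\<^sup>2 + p y
        \<le> 1 / 2 * (L2_norm M (\<lambda>\<omega>. y \<omega> - T x \<omega>))\<^sup>2 + p x"
      using le[OF y TL[OF x]] by (simp add: p x y)
    moreover have "(\<integral>\<omega>. T x \<omega> \<bullet> (y \<omega> - x \<omega>) \<partial>M)
        = (\<integral>\<omega>. y \<omega> \<bullet> T x \<omega> \<partial>M) - (\<integral>\<omega>. x \<omega> \<bullet> T x \<omega> \<partial>M)"
      using L2_inner_integrable[OF y TL[OF x]] L2_inner_integrable[OF x TL[OF x]]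
      by (simp add: inner_diff_right inner_commute)
    ultimately show ?thesis
      unfolding \<psi>_def L2_norm_sq_diff[OF y TL[OF x]] L2_norm_sq_diff[OF y TL[OF y]]
      by (simp add: field_simps)
  qed
  then show ?thesis by (rule that)
qed

text \<open>
  On the plane through \<open>u\<close> spanned by \<open>g\<close> and \<open>v\<close>, the assumption says that the derivative of the
  potential along \<open>v\<close> does not depend on the \<open>g\<close>-coordinate; hence its derivative along \<open>g\<close>, which is
  \<open>\<langle>T x, g\<rangle>\<close>, does not depend on the \<open>v\<close>-coordinate.
\<close>
lemma continuous_prox_reciprocity:
  assumes prox: "continuous_prox M T"
    and L2: "u \<in> L2 M" "g \<in> L2 M" "v \<in> L2 M"
    and indep: "\<And>\<sigma> \<tau>. (\<integral>\<omega>. T (\<lambda>\<omega>. u \<omega> + \<sigma> *\<^sub>R g \<omega> + \<tau> *\<^sub>R v \<omega>) \<omega> \<bullet> v \<omega> \<partial>M)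
      = (\<integral>\<omega>. T (\<lambda>\<omega>. u \<omega> + \<tau> *\<^sub>R v \<omega>) \<omega> \<bullet> v \<omega> \<partial>M)"
  shows "(\<integral>\<omega>. T (\<lambda>\<omega>. u \<omega> + v \<omega>) \<omega> \<bullet> g \<omega> \<partial>M) = (\<integral>\<omega>. T u \<omega> \<bullet> g \<omega> \<partial>M)"
proof -
  have T: "L2_map M T" "L2_continuous M T" using prox by (auto simp: continuous_prox_def)
  obtain \<psi> where \<psi>: "\<And>x y. x \<in> L2 M \<Longrightarrow> y \<in> L2 M \<Longrightarrow>
    (\<integral>\<omega>. T x \<omega> \<bullet> (y \<omega> - x \<omega>) \<partial>M) \<le> \<psi> y - \<psi> x"
    using continuous_prox_subgradient[OF prox] by blast
  define x where "x \<sigma> \<tau> \<omega> = u \<omega> + \<sigma> *\<^sub>R g \<omega> + \<tau> *\<^sub>R v \<omega>" for \<sigma> \<tau> \<omega>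
  have x: "x \<sigma> \<tau> \<in> L2 M" for \<sigma> \<tau>
    unfolding x_def by (intro L2_add L2_scaleR L2)
  then have Tx: "T (x \<sigma> \<tau>) \<in> L2 M" for \<sigma> \<tau> using T by (simp add: L2_map_def)
  define P where "P \<sigma> \<tau> = (\<integral>\<omega>. T (x \<sigma> \<tau>) \<omega> \<bullet> g \<omega> \<partial>M)" for \<sigma> \<tau>
  define Q where "Q \<tau> = (\<integral>\<omega>. T (\<lambda>\<omega>. u \<omega> + \<tau> *\<^sub>R v \<omega>) \<omega> \<bullet> v \<omega> \<partial>M)" for \<tau>
  have "(\<sigma>' - \<sigma>) * P \<sigma> \<tau> + (\<tau>' - \<tau>) * Q \<tau> \<le> \<psi> (x \<sigma>' \<tau>') - \<psi> (x \<sigma> \<tau>)" for \<sigma> \<tau> \<sigma>' \<tau>'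
  proof -
    have "Q \<tau> = (\<integral>\<omega>. T (x \<sigma> \<tau>) \<omega> \<bullet> v \<omega> \<partial>M)"
      by (simp add: Q_def x_def[abs_def] indep)
    moreover have "T (x \<sigma> \<tau>) \<omega> \<bullet> (x \<sigma>' \<tau>' \<omega> - x \<sigma> \<tau> \<omega>)
        = (\<sigma>' - \<sigma>) * (T (x \<sigma> \<tau>) \<omega> \<bullet> g \<omega>) + (\<tau>' - \<tau>) * (T (x \<sigma> \<tau>) \<omega> \<bullet> v \<omega>)" for \<omega>
      by (simp add: x_def inner_simps algebra_simps)
    ultimately have "(\<sigma>' - \<sigma>) * P \<sigma> \<tau> + (\<tau>' - \<tau>) * Q \<tau>
        = (\<integral>\<omega>. T (x \<sigma> \<tau>) \<omega> \<bullet> (x \<sigma>' \<tau>' \<omega> - x \<sigma> \<tau> \<omega>) \<partial>M)"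
      using L2_inner_integrable[OF Tx L2(2)] L2_inner_integrable[OF Tx L2(3)]
      by (simp add: P_def)
    then show ?thesis using \<psi>[OF x x] by simp
  qed
  moreover have "isCont (\<lambda>\<sigma>. P \<sigma> \<tau>) \<sigma>" for \<sigma> \<tau>
  proof -
    have "P \<sigma> \<tau> = (\<integral>\<omega>. T (\<lambda>\<omega>. (u \<omega> + \<tau> *\<^sub>R v \<omega>) + \<sigma> *\<^sub>R g \<omega>) \<omega> \<bullet> g \<omega> \<partial>M)" for \<sigma>
      by (simp add: P_def x_def[abs_def] add_ac)
    then show ?thesis
      using isCont_L2_inner_along_line[OF T L2_add[OF L2(1) L2_scaleR[OF L2(3)]] L2(2) L2(2)]
      by simp
  qed
  moreover have "isCont Q \<tau>" for \<tau>
    unfolding Q_def by (rule isCont_L2_inner_along_line[OF T L2(1) L2(3) L2(3)])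
  ultimately have "P 0 1 = P 0 0"
    by (rule cross_independence_of_subgradients[where F = "\<lambda>\<sigma> \<tau>. \<psi> (x \<sigma> \<tau>)"])
  then show ?thesis by (simp add: P_def x_def[abs_def])
qed

section \<open>Iterates of an invertible measure-preserving transformation\<close>

lemma iter_closed:
  assumes "invertible_mpt M \<theta>" "\<omega> \<in> space M"
  shows "iter M \<theta> k \<omega> \<in> space M"
proof -
  have "(f ^^ n) \<omega> \<in> space M" if "f \<in> space M \<rightarrow> space M" for f and n :: nat
    using that assms(2) by (induction n) auto
  moreover have "\<theta> \<in> space M \<rightarrow> space M" "inv_into (space M) \<theta> \<in> space M \<rightarrow> space M"
    using assms(1) by (auto simp: invertible_mpt_def dest: measurable_space)
  ultimately show ?thesis by (simp add: iter_def)
qed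

lemma iter_measurable:
  assumes "invertible_mpt M \<theta>"
  shows "iter M \<theta> k \<in> measurable M M"
proof -
  have "\<theta> \<in> measurable M M" "inv_into (space M) \<theta> \<in> measurable M M"
    using assms by (auto simp: invertible_mpt_def)
  then show ?thesis by (simp add: iter_def measurable_compose_n)
qed

lemma iter_add_one:
  assumes "invertible_mpt M \<theta>" "\<omega> \<in> space M"
  shows "iter M \<theta> (k + 1) \<omega> = \<theta> (iter M \<theta> k \<omega>)"
proof (cases "0 \<le> k")
  case True
  then show ?thesis by (simp add: iter_def nat_add_distrib)
next
  case False
  then obtain n where n: "k = - int (Suc n)"
    by (metis int_cases linorder_not_le of_nat_0_le_iff)
  have bij: "bij_betw \<theta> (space M) (space M)" using assms by (simp add: invertible_mpt_def)
  have "iter M \<theta> k \<omega> = inv_into (space M) \<theta> (iter M \<theta> (- int n) \<omega>)"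
    by (simp add: iter_def n nat_add_distrib)
  then have "\<theta> (iter M \<theta> k \<omega>) = iter M \<theta> (- int n) \<omega>"
    using bij iter_closed[OF assms, of "- int n"] by (simp add: bij_betw_inv_into_right)
  then show ?thesis by (simp add: n)
qed

lemma iter_add:
  assumes "invertible_mpt M \<theta>" "\<omega> \<in> space M"
  shows "iter M \<theta> (j + k) \<omega> = iter M \<theta> j (iter M \<theta> k \<omega>)"
proof (induction j rule: int_induct[where k = 0])
  case base
  then show ?case by (simp add: iter_def)
next
  case (step1 j)
  then show ?case
    using iter_add_one[OF assms, of "j + k"] iter_add_one[OF assms(1) iter_closed[OF assms, of k], of j]
    by (simp add: add_ac)
next
  case (step2 j)
  let ?x = "iter M \<theta> (j - 1 + k) \<omega>" and ?y = "iter M \<theta> (j - 1) (iter M \<theta> k \<omega>)"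
  have "\<theta> ?x = \<theta> ?y"
    using step2 iter_add_one[OF assms, of "j - 1 + k"]
      iter_add_one[OF assms(1) iter_closed[OF assms, of k], of "j - 1"]
    by (simp add: algebra_simps)
  moreover have "inj_on \<theta> (space M)"
    using assms by (simp add: invertible_mpt_def bij_betw_def)
  ultimately show ?case
    using assms by (meson inj_onD iter_closed)
qed

lemma iter_zero: "iter M \<theta> 0 \<omega> = \<omega>"
  by (simp add: iter_def)

lemma iter_cancel:
  assumes "invertible_mpt M \<theta>" "\<omega> \<in> space M"
  shows "iter M \<theta> k (iter M \<theta> (- k) \<omega>) = \<omega>" "iter M \<theta> (- k) (iter M \<theta> k \<omega>) = \<omega>"
  using iter_add[OF assms, of k "- k"] iter_add[OF assms, of "- k" k] by (simp_all add: iter_zero)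

lemma AE_iter:
  assumes "invertible_mpt M \<theta>" "AE \<omega> in M. P \<omega>"
  shows "AE \<omega> in M. P (iter M \<theta> k \<omega>)"
proof -
  have step: "AE \<omega> in M. R (\<theta> \<omega>)" if "AE \<omega> in M. R \<omega>" for R
    using AE_distrD[of \<theta> M M R] assms(1) that unfolding invertible_mpt_def by metis
  have inv_step: "AE \<omega> in M. R (inv_into (space M) \<theta> \<omega>)" if "AE \<omega> in M. R \<omega>" for R
  proof -
    have meas [measurable]: "inv_into (space M) \<theta> \<in> measurable M M" "\<theta> \<in> measurable M M"
      and bij: "bij_betw \<theta> (space M) (space M)" and distr: "distr M M \<theta> = M"
      using assms(1) by (auto simp: invertible_mpt_def)
    have "distr M M (inv_into (space M) \<theta>) = distr (distr M M \<theta>) M (inv_into (space M) \<theta>)"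
      by (simp add: distr)
    also have "\<dots> = distr M M (inv_into (space M) \<theta> \<circ> \<theta>)"
      by (rule distr_distr) measurable
    also have "\<dots> = distr M M (\<lambda>\<omega>. \<omega>)"
      using bij by (intro distr_cong) (auto simp: bij_betw_inv_into_left)
    finally have "distr M M (inv_into (space M) \<theta>) = M" by (simp add: distr_id)
    then show ?thesis using AE_distrD[OF meas(1), of R] that by metis
  qed
  have power: "AE \<omega> in M. R ((f ^^ n) \<omega>)"
    if "AE \<omega> in M. R \<omega>" "\<And>R. AE \<omega> in M. R \<omega> \<Longrightarrow> AE \<omega> in M. R (f \<omega>)" for f R and n :: nat
    using that(1)
  proof (induction n arbitrary: R)
    case (Suc n)
    from Suc.IH[OF that(2)[OF Suc.prems]] show ?case by simp
  qed simp
  show ?thesis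
  proof (cases "0 \<le> k")
    case True
    have "AE \<omega> in M. P ((\<theta> ^^ nat k) \<omega>)"
      by (rule power[OF assms(2)]) (rule step)
    with True show ?thesis by (simp add: iter_def)
  next
    case False
    have "AE \<omega> in M. P ((inv_into (space M) \<theta> ^^ nat (- k)) \<omega>)"
      by (rule power[OF assms(2)]) (rule inv_step)
    with False show ?thesis by (simp add: iter_def)
  qed
qed

section \<open>Countable covers by sets with disjoint translates\<close>

text \<open>
  Disjointness of the images \<open>\<theta>\<^sup>a A\<close>, phrased through points because the arguments below ask where a
  single point of an orbit can lie.
\<close>
definition disjoint_translates :: "'a measure \<Rightarrow> ('a \<Rightarrow> 'a) \<Rightarrow> int set \<Rightarrow> 'a set \<Rightarrow> bool" where
  "disjoint_translates M \<theta> F A \<longleftrightarrow>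
     (\<forall>x\<in>A. \<forall>y\<in>A. \<forall>a\<in>F. \<forall>b\<in>F. a \<noteq> b \<longrightarrow> iter M \<theta> a x \<noteq> iter M \<theta> b y)"

lemma standard_borel_separating:
  assumes "standard_borel N"
  obtains \<B> where "countable \<B>" "\<B> \<subseteq> sets N"
    "\<And>x y. x \<in> space N \<Longrightarrow> y \<in> space N \<Longrightarrow> x \<noteq> y \<Longrightarrow> \<exists>B\<in>\<B>. x \<in> B \<and> y \<notin> B"
proof -
  obtain X where X: "completely_metrizable_space X" "second_countable X" "topspace X = space N"
    "sets N = sigma_sets (space N) {U. openin X U}"
    using assms by (auto simp: standard_borel_def)
  obtain \<B> where \<B>: "countable \<B>" "\<And>V. V \<in> \<B> \<Longrightarrow> openin X V"
    "\<And>U x. openin X U \<Longrightarrow> x \<in> U \<Longrightarrow> \<exists>V\<in>\<B>. x \<in> V \<and> V \<subseteq> U"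
    using X(2) unfolding second_countable_def by metis
  show ?thesis
  proof
    show "countable \<B>" by fact
    show "\<B> \<subseteq> sets N" using \<B>(2) by (auto simp: X(4))
    fix x y assume "x \<in> space N" "y \<in> space N" "x \<noteq> y"
    moreover have "t1_space X"
      using X(1) by (simp add: completely_metrizable_imp_metrizable_space metrizable_imp_t1_space)
    ultimately obtain U where "openin X U" "x \<in> U" "y \<notin> U"
      using X(3) unfolding t1_space_def by metis
    then show "\<exists>B\<in>\<B>. x \<in> B \<and> y \<notin> B" using \<B>(3) by blast
  qed
qed

text \<open>
  A countable base of the underlying Polish space separates points. Its members are measurable for the
  given measure and for its completion alike, so both conventions for standard spaces are covered.
\<close>
lemma standard_prob_space_separating:
  assumes "standard_prob_space M"
  obtains \<B> \<Omega> where "countable \<B>" "\<B> \<subseteq> sets M" "AE \<omega> in M. \<omega> \<in> \<Omega>"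
    "\<And>x y. x \<in> \<Omega> \<Longrightarrow> y \<in> \<Omega> \<Longrightarrow> x \<noteq> y \<Longrightarrow> \<exists>B\<in>\<B>. x \<in> B \<and> y \<notin> B"
proof -
  interpret prob_space M using assms by (simp add: standard_prob_space_def)
  obtain \<Omega> N where \<Omega>: "\<Omega> \<in> sets M" "prob \<Omega> = 1" and N: "standard_borel N"
    "restrict_space M \<Omega> = N \<or> restrict_space M \<Omega> = completion N"
    using assms unfolding standard_prob_space_def by blast
  obtain \<B> where \<B>: "countable \<B>" "\<B> \<subseteq> sets N"
    "\<And>x y. x \<in> space N \<Longrightarrow> y \<in> space N \<Longrightarrow> x \<noteq> y \<Longrightarrow> \<exists>B\<in>\<B>. x \<in> B \<and> y \<notin> B"
    using standard_borel_separating[OF N(1)] by blast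
  have sp: "space N = \<Omega>"
    using N(2) sets.sets_into_space[OF \<Omega>(1)]
    by (metis inf.absorb1 space_completion space_restrict_space)
  have "\<B> \<subseteq> sets (restrict_space M \<Omega>)"
    using N(2) \<B>(2) by auto
  then have "\<B> \<subseteq> sets M"
    using \<Omega>(1) by (auto simp: sets_restrict_space_iff)
  moreover have "AE \<omega> in M. \<omega> \<in> \<Omega>"
    using \<Omega> by (simp add: prob_eq_1)
  ultimately show ?thesis
    using that[of \<B> \<Omega>] \<B> by (simp add: sp)
qed

text \<open>
  For each pair of distinct exponents \<open>(a, b)\<close>, choose a separating set \<open>f (a, b)\<close> that contains
  \<open>\<theta>\<^sup>a \<omega>\<close> but not \<open>\<theta>\<^sup>b \<omega>\<close>. All points sharing the choice \<open>f\<close> form a set with disjoint translates,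
  and there are countably many choices since only finitely many pairs occur.
\<close>
lemma countable_cover_disjoint_translates:
  assumes std: "standard_prob_space M" and mpt: "invertible_mpt M \<theta>" and fin: "finite F"
    and free: "\<And>a b. a \<in> F \<Longrightarrow> b \<in> F \<Longrightarrow> a \<noteq> b \<Longrightarrow> AE \<omega> in M. iter M \<theta> a \<omega> \<noteq> iter M \<theta> b \<omega>"
  obtains \<A> where "countable \<A>" "\<A> \<subseteq> sets M" "AE \<omega> in M. \<omega> \<in> \<Union>\<A>"
    "\<And>A. A \<in> \<A> \<Longrightarrow> disjoint_translates M \<theta> F A"
proof -
  obtain \<B> \<Omega> where \<B>: "countable \<B>" "\<B> \<subseteq> sets M" and \<Omega>: "AE \<omega> in M. \<omega> \<in> \<Omega>"
    and sep: "\<And>x y. x \<in> \<Omega> \<Longrightarrow> y \<in> \<Omega> \<Longrightarrow> x \<noteq> y \<Longrightarrow> \<exists>B\<in>\<B>. x \<in> B \<and> y \<notin> B"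
    using standard_prob_space_separating[OF std] by blast
  define D where "D = {(a, b). a \<in> F \<and> b \<in> F \<and> a \<noteq> b}"
  have finD: "finite D"
    by (rule finite_subset[of _ "F \<times> F"]) (auto simp: D_def fin)
  define cell where "cell f = {\<omega> \<in> space M. \<forall>d\<in>D.
    iter M \<theta> (fst d) \<omega> \<in> f d \<and> iter M \<theta> (snd d) \<omega> \<notin> f d}" for f
  define \<A> where "\<A> = cell ` (PiE D (\<lambda>_. \<B>))"
  note [measurable] = iter_measurable[OF mpt]
  show ?thesis
  proof
    show "countable \<A>"
      unfolding \<A>_def by (intro countable_image countable_PiE finD \<B>)
    show "\<A> \<subseteq> sets M"
    proof
      fix A assume "A \<in> \<A>"
      then obtain f where f: "f \<in> PiE D (\<lambda>_. \<B>)" "A = cell f" by (auto simp: \<A>_def)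
      show "A \<in> sets M"
        unfolding f(2) cell_def
      proof (rule sets.sets_Collect_finite_All[OF _ finD])
        fix d assume "d \<in> D"
        then have [measurable]: "f d \<in> sets M" using f(1) \<B>(2) by (auto simp: PiE_iff)
        show "{\<omega> \<in> space M. iter M \<theta> (fst d) \<omega> \<in> f d \<and> iter M \<theta> (snd d) \<omega> \<notin> f d} \<in> sets M"
          by measurable
      qed
    qed
    show "disjoint_translates M \<theta> F A" if A: "A \<in> \<A>" for A
      unfolding disjoint_translates_def
    proof (intro ballI impI)
      fix x y a b assume *: "x \<in> A" "y \<in> A" "a \<in> F" "b \<in> F" "a \<noteq> b"
      obtain f where "A = cell f" using A by (auto simp: \<A>_def)
      moreover have "(a, b) \<in> D" using * by (simp add: D_def)
      ultimately have "iter M \<theta> a x \<in> f (a, b)" "iter M \<theta> b y \<notin> f (a, b)"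
        using * by (auto simp: cell_def)
      then show "iter M \<theta> a x \<noteq> iter M \<theta> b y" by metis
    qed
    have "AE \<omega> in M. \<forall>a\<in>F. iter M \<theta> a \<omega> \<in> \<Omega>"
      using fin \<Omega> by (intro AE_finite_allI AE_iter[OF mpt])
    moreover have "AE \<omega> in M. \<forall>d\<in>D. iter M \<theta> (fst d) \<omega> \<noteq> iter M \<theta> (snd d) \<omega>"
      using free finD by (intro AE_finite_allI) (auto simp: D_def)
    ultimately show "AE \<omega> in M. \<omega> \<in> \<Union>\<A>"
      using AE_space
    proof eventually_elim
      case (elim \<omega>)
      have "\<exists>B. B \<in> \<B> \<and> iter M \<theta> (fst d) \<omega> \<in> B \<and> iter M \<theta> (snd d) \<omega> \<notin> B" if "d \<in> D" for d
      proof -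
        have "fst d \<in> F" "snd d \<in> F" using that by (auto simp: D_def)
        then show ?thesis
          using sep[of "iter M \<theta> (fst d) \<omega>" "iter M \<theta> (snd d) \<omega>"] elim(1,2) that by blast
      qed
      then obtain f where "\<forall>d\<in>D. f d \<in> \<B> \<and> iter M \<theta> (fst d) \<omega> \<in> f d \<and> iter M \<theta> (snd d) \<omega> \<notin> f d"
        by metis
      then have "restrict f D \<in> PiE D (\<lambda>_. \<B>)" "\<omega> \<in> cell (restrict f D)"
        using elim by (auto simp: cell_def)
      then show ?case unfolding \<A>_def by (meson UnionI imageI)
    qed
  qed
qed

section \<open>Locality of the memory\<close>

text \<open>
  Let \<open>u\<close> and \<open>w\<close> differ on \<open>A\<close> only, and let \<open>\<omega> = \<theta>\<^sup>k x\<close> with \<open>x \<in> A\<close>. The representation reads the input at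
  \<open>\<theta>\<^sup>s \<omega> = \<theta>\<^bsup>s + k\<^esup> x\<close>, which lies outside \<open>A = \<theta>\<^sup>0 A\<close> unless \<open>s = -k\<close>. The comparison of the
  exponents \<open>s + k\<close> and \<open>0\<close> is where sums of two lags come in.
\<close>
lemma inactive_reverse_lag_imp_blind:
  assumes mpt: "invertible_mpt M \<theta>" and rep: "memory_representation M \<theta> S T t"
    and F: "0 \<in> F" "\<And>s. s \<in> S \<Longrightarrow> s + k \<in> F"
    and disj: "disjoint_translates M \<theta> F A"
    and inact: "- k \<in> S \<Longrightarrow> lag_inactive M S t (- k)"
    and L2: "u \<in> L2 M" "w \<in> L2 M"
    and eq: "\<And>\<omega>. \<omega> \<in> space M \<Longrightarrow> \<omega> \<notin> A \<Longrightarrow> u \<omega> = w \<omega>"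
  shows "AE \<omega> in M. iter M \<theta> (- k) \<omega> \<in> A \<longrightarrow> T u \<omega> = T w \<omega>"
proof -
  define zu where "zu \<omega> = (\<lambda>s\<in>S. u (iter M \<theta> s \<omega>))" for \<omega>
  define zw where "zw \<omega> = (\<lambda>s\<in>S. w (iter M \<theta> s \<omega>))" for \<omega>
  have agree: "zu \<omega> s = zw \<omega> s"
    if "\<omega> \<in> space M" "iter M \<theta> (- k) \<omega> \<in> A" "s \<noteq> - k" for s \<omega>
  proof (cases "s \<in> S")
    case True
    let ?x = "iter M \<theta> (- k) \<omega>"
    have "iter M \<theta> s \<omega> = iter M \<theta> (s + k) ?x"
      using iter_add[OF mpt that(1), of "s + k" "- k"] by simp
    moreover have "iter M \<theta> (s + k) ?x \<noteq> iter M \<theta> 0 y" if "y \<in> A" for y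
      using disj F True that \<open>?x \<in> A\<close> \<open>s \<noteq> - k\<close>
      unfolding disjoint_translates_def by (metis add.commute add_eq_0_iff)
    ultimately have "iter M \<theta> s \<omega> \<notin> A" by (metis iter_zero)
    then show ?thesis
      using eq iter_closed[OF mpt that(1)] by (simp add: zu_def zw_def)
  qed (simp add: zu_def zw_def)
  have same: "AE \<omega> in M. iter M \<theta> (- k) \<omega> \<in> A \<longrightarrow> t \<omega> (zu \<omega>) = t \<omega> (zw \<omega>)"
  proof (cases "- k \<in> S")
    case True
    from inact[OF True] have "AE \<omega> in M. \<forall>z\<in>PiE S (\<lambda>_. UNIV). \<forall>h. t \<omega> (z(- k := h)) = t \<omega> z"
      by (simp add: lag_inactive_def)
    then show ?thesis
      using AE_space
    proof eventually_elim
      case (elim \<omega>)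
      show ?case
      proof
        assume "iter M \<theta> (- k) \<omega> \<in> A"
        then have "zw \<omega> = (zu \<omega>)(- k := zw \<omega> (- k))"
          using agree elim by (auto simp: fun_eq_iff)
        moreover have "zu \<omega> \<in> PiE S (\<lambda>_. UNIV)" by (simp add: zu_def)
        ultimately show "t \<omega> (zu \<omega>) = t \<omega> (zw \<omega>)" using elim by metis
      qed
    qed
  next
    case False
    have "zu \<omega> = zw \<omega>" if "\<omega> \<in> space M" "iter M \<theta> (- k) \<omega> \<in> A" for \<omega>
    proof
      fix s show "zu \<omega> s = zw \<omega> s"
        using agree[OF that, of s] False by (cases "s = - k") (auto simp: zu_def zw_def)
    qed
    then show ?thesis using AE_space by (auto elim!: eventually_mono)
  qed
  have "AE \<omega> in M. T u \<omega> = t \<omega> (zu \<omega>)" "AE \<omega> in M. T w \<omega> = t \<omega> (zw \<omega>)"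
    using rep L2 by (auto simp: memory_representation_def zu_def zw_def)
  with same show ?thesis by eventually_elim simp
qed

text \<open>
  Reciprocity is applied with the direction \<open>g\<close> chosen as the restriction to \<open>A\<close> of the change
  \<open>T (u + v) - T u\<close> itself. The vanishing of \<open>\<langle>T (u + v) - T u, g\<rangle>\<close> then says that this change has norm
  zero on \<open>A\<close>.
\<close>
lemma translate_perturbation_invisible:
  assumes mpt: "invertible_mpt M \<theta>" and rep: "memory_representation M \<theta> S T t"
    and prox: "continuous_prox M T"
    and F: "0 \<in> F" "\<And>s. s \<in> S \<Longrightarrow> s + k \<in> F"
    and A: "A \<in> sets M" "disjoint_translates M \<theta> F A"
    and inact: "- k \<in> S \<Longrightarrow> lag_inactive M S t (- k)"
    and L2: "u \<in> L2 M" "v \<in> L2 M"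
    and supp: "\<And>\<omega>. iter M \<theta> (- k) \<omega> \<notin> A \<Longrightarrow> v \<omega> = 0"
  shows "AE \<omega> in M. \<omega> \<in> A \<longrightarrow> T (\<lambda>\<omega>. u \<omega> + v \<omega>) \<omega> = T u \<omega>"
proof -
  let ?uv = "\<lambda>\<omega>. u \<omega> + v \<omega>"
  have TL: "T x \<in> L2 M" if "x \<in> L2 M" for x
    using prox that by (simp add: continuous_prox_def L2_map_def)
  have uv: "?uv \<in> L2 M" by (intro L2_add L2)
  define g where "g \<omega> = indicator A \<omega> *\<^sub>R (T ?uv \<omega> - T u \<omega>)" for \<omega>
  have g: "g \<in> L2 M"
    unfolding g_def by (intro L2_restrict L2_diff TL uv L2 A)
  have "(\<integral>\<omega>. T (\<lambda>\<omega>. u \<omega> + \<sigma> *\<^sub>R g \<omega> + \<tau> *\<^sub>R v \<omega>) \<omega> \<bullet> v \<omega> \<partial>M)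
      = (\<integral>\<omega>. T (\<lambda>\<omega>. u \<omega> + \<tau> *\<^sub>R v \<omega>) \<omega> \<bullet> v \<omega> \<partial>M)" for \<sigma> \<tau>
  proof -
    let ?x = "\<lambda>\<omega>. u \<omega> + \<sigma> *\<^sub>R g \<omega> + \<tau> *\<^sub>R v \<omega>" and ?y = "\<lambda>\<omega>. u \<omega> + \<tau> *\<^sub>R v \<omega>"
    have x: "?x \<in> L2 M" and y: "?y \<in> L2 M"
      by (intro L2_add L2_scaleR L2 g)+
    have "AE \<omega> in M. iter M \<theta> (- k) \<omega> \<in> A \<longrightarrow> T ?x \<omega> = T ?y \<omega>"
      by (rule inactive_reverse_lag_imp_blind[OF mpt rep F A(2) inact x y]) (auto simp: g_def)
    then have "AE \<omega> in M. T ?x \<omega> \<bullet> v \<omega> = T ?y \<omega> \<bullet> v \<omega>"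
      by eventually_elim (metis supp inner_zero_right)
    moreover have "(\<lambda>\<omega>. T ?x \<omega> \<bullet> v \<omega>) \<in> borel_measurable M" "(\<lambda>\<omega>. T ?y \<omega> \<bullet> v \<omega>) \<in> borel_measurable M"
      using L2_inner_integrable[OF TL L2(2)] x y by (auto intro: borel_measurable_integrable)
    ultimately show ?thesis by (intro integral_cong_AE)
  qed
  from continuous_prox_reciprocity[OF prox L2(1) g L2(2) this]
  have "(\<integral>\<omega>. T ?uv \<omega> \<bullet> g \<omega> - T u \<omega> \<bullet> g \<omega> \<partial>M) = 0"
    using L2_inner_integrable[OF TL g] uv L2(1) by simp
  moreover have "T ?uv \<omega> \<bullet> g \<omega> - T u \<omega> \<bullet> g \<omega> = (norm (g \<omega>))\<^sup>2" for \<omega>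
    by (auto simp: g_def indicator_def power2_norm_eq_inner inner_diff_left inner_diff_right)
  ultimately have "(\<integral>\<omega>. (norm (g \<omega>))\<^sup>2 \<partial>M) = 0" by simp
  then have "AE \<omega> in M. (norm (g \<omega>))\<^sup>2 = 0"
    using g by (simp add: integral_nonneg_eq_0_iff_AE L2_def)
  then show ?thesis by eventually_elim (auto simp: g_def indicator_def)
qed

section \<open>Reading off the representation\<close>

text \<open>
  The sum below takes the value \<open>z s\<close> on the translate \<open>\<theta>\<^sup>s A\<close>, at least when these translates are
  disjoint: an input that makes the representation read the prescribed vector \<open>z\<close> at every point of \<open>A\<close>.
\<close>
lemma (in prob_space) L2_tower_function:
  assumes mpt: "invertible_mpt M \<theta>" and "A \<in> sets M"
  shows "(\<lambda>\<omega>. \<Sum>s\<in>S. indicator A (iter M \<theta> (- s) \<omega>) *\<^sub>R z s) \<in> L2 M"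
proof -
  note [measurable] = iter_measurable[OF mpt] \<open>A \<in> sets M\<close>
  have "norm (\<Sum>s\<in>S. indicator A (iter M \<theta> (- s) \<omega>) *\<^sub>R z s) \<le> (\<Sum>s\<in>S. norm (z s))" for \<omega>
    by (rule sum_norm_le) (simp add: indicator_def)
  then have "integrable M (\<lambda>\<omega>. (norm (\<Sum>s\<in>S. indicator A (iter M \<theta> (- s) \<omega>) *\<^sub>R z s))\<^sup>2)"
    by (intro integrable_const_bound[where B = "(\<Sum>s\<in>S. norm (z s))\<^sup>2"]) (auto intro!: power_mono)
  then show ?thesis by (simp add: L2_def)
qed

lemma tower_function_on_translate:
  fixes z :: "int \<Rightarrow> 'h::real_vector"
  assumes mpt: "invertible_mpt M \<theta>" and "finite S" and A: "A \<subseteq> space M" "disjoint_translates M \<theta> S A"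
    and "r \<in> S" "\<omega> \<in> A"
  shows "(\<Sum>s\<in>S. indicator A (iter M \<theta> (- s) (iter M \<theta> r \<omega>)) *\<^sub>R z s) = z r"
proof -
  have \<omega>: "\<omega> \<in> space M" using A \<open>\<omega> \<in> A\<close> by blast
  have "indicator A (iter M \<theta> (- s) (iter M \<theta> r \<omega>)) *\<^sub>R z s = (if s = r then z r else 0)"
    if "s \<in> S" for s
  proof (cases "s = r")
    case True
    then show ?thesis using iter_cancel[OF mpt \<omega>] \<open>\<omega> \<in> A\<close> by simp
  next
    case False
    have "iter M \<theta> (- s) (iter M \<theta> r \<omega>) \<notin> A"
      using A(2) False that \<open>r \<in> S\<close> \<open>\<omega> \<in> A\<close> iter_cancel[OF mpt iter_closed[OF mpt \<omega>, of r], of s]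
      unfolding disjoint_translates_def by metis
    with False show ?thesis by simp
  qed
  then have "(\<Sum>s\<in>S. indicator A (iter M \<theta> (- s) (iter M \<theta> r \<omega>)) *\<^sub>R z s)
      = (\<Sum>s\<in>S. if s = r then z r else 0)"
    by (intro sum.cong) auto
  then show ?thesis using assms by simp
qed

text \<open>
  The inputs realising \<open>z\<close> and \<open>z(k := h)\<close> on \<open>A\<close> differ on \<open>\<theta>\<^sup>k A\<close> only, so \<open>T\<close> gives them the same
  output on \<open>A\<close>.
\<close>
lemma (in prob_space) representation_blind_at_constants:
  assumes mpt: "invertible_mpt M \<theta>" and rep: "memory_representation M \<theta> S T t"
    and prox: "continuous_prox M T" and "finite S" "k \<in> S"
    and F: "0 \<in> F" "S \<subseteq> F" "\<And>s. s \<in> S \<Longrightarrow> s + k \<in> F"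
    and A: "A \<in> sets M" "disjoint_translates M \<theta> F A"
    and inact: "- k \<in> S \<Longrightarrow> lag_inactive M S t (- k)"
    and z: "z \<in> PiE S (\<lambda>_. UNIV)"
  shows "AE \<omega> in M. \<omega> \<in> A \<longrightarrow> t \<omega> (z(k := h)) = t \<omega> z"
proof -
  define tower where "tower z \<omega> = (\<Sum>s\<in>S. indicator A (iter M \<theta> (- s) \<omega>) *\<^sub>R z s)" for z :: "int \<Rightarrow> 'b" and \<omega>
  have tower: "tower z \<in> L2 M" for z
    unfolding tower_def by (rule L2_tower_function[OF mpt A(1)])
  have A': "A \<subseteq> space M" "disjoint_translates M \<theta> S A"
    using sets.sets_into_space[OF A(1)] A(2) F(2) unfolding disjoint_translates_def by blast+
  have read: "AE \<omega> in M. \<omega> \<in> A \<longrightarrow> T (tower z) \<omega> = t \<omega> z" if "z \<in> PiE S (\<lambda>_. UNIV)" for z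
  proof -
    have "(\<lambda>s\<in>S. tower z (iter M \<theta> s \<omega>)) = z" if "\<omega> \<in> A" for \<omega>
    proof
      fix s show "(\<lambda>s\<in>S. tower z (iter M \<theta> s \<omega>)) s = z s"
      proof (cases "s \<in> S")
        case True
        then have "tower z (iter M \<theta> s \<omega>) = z s"
          unfolding tower_def by (rule tower_function_on_translate[OF mpt \<open>finite S\<close> A' _ that])
        with True show ?thesis by simp
      next
        case False
        then show ?thesis using PiE_arb[OF \<open>z \<in> PiE S (\<lambda>_. UNIV)\<close> False] by simp
      qed
    qed
    moreover have "AE \<omega> in M. T (tower z) \<omega> = t \<omega> (\<lambda>s\<in>S. tower z (iter M \<theta> s \<omega>))"
      using rep tower by (auto simp: memory_representation_def)
    ultimately show ?thesis by (auto elim!: eventually_mono)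
  qed
  define v where "v \<omega> = tower (z(k := h)) \<omega> - tower z \<omega>" for \<omega>
  have v: "v \<in> L2 M" unfolding v_def by (intro L2_diff tower)
  have "v \<omega> = 0" if "iter M \<theta> (- k) \<omega> \<notin> A" for \<omega>
    unfolding v_def tower_def right_minus_eq using that by (intro sum.cong) auto
  from translate_perturbation_invisible[OF mpt rep prox F(1,3) A inact tower[of z] v this]
  have "AE \<omega> in M. \<omega> \<in> A \<longrightarrow> T (tower (z(k := h))) \<omega> = T (tower z) \<omega>"
    by (simp add: v_def)
  moreover have "z(k := h) \<in> PiE S (\<lambda>_. UNIV)"
    using z \<open>k \<in> S\<close> by (auto simp: PiE_iff extensional_def)
  then have "AE \<omega> in M. \<omega> \<in> A \<longrightarrow> T (tower (z(k := h))) \<omega> = t \<omega> (z(k := h))"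
    by (rule read)
  ultimately show ?thesis
    using read[OF z] by eventually_elim simp
qed

lemma continuous_map_blind_from_dense:
  fixes f :: "('i \<Rightarrow> 'h::metric_space) \<Rightarrow> 'h"
  assumes cont: "continuous_map (product_topology (\<lambda>_. euclidean) S) euclidean f"
    and dense: "closure D = UNIV" and "k \<in> S"
    and eq: "\<And>z h. z \<in> PiE S (\<lambda>_. D) \<Longrightarrow> h \<in> D \<Longrightarrow> f (z(k := h)) = f z"
    and z: "z \<in> PiE S (\<lambda>_. UNIV)"
  shows "f (z(k := h)) = f z"
proof -
  have "\<exists>X. (\<forall>n. X n \<in> D) \<and> X \<longlonglongrightarrow> x" for x
    using dense closure_sequential[of x D] by auto
  then obtain X where X: "\<And>x n. X x n \<in> D" "\<And>x. X x \<longlonglongrightarrow> x" by metis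
  define Z where "Z n = (\<lambda>s\<in>S. X (z s) n)" for n
  have Z: "Z n \<in> PiE S (\<lambda>_. D)" for n by (simp add: Z_def X)
  have lim_Z: "limitin (product_topology (\<lambda>_. euclidean) S) Z z sequentially"
    using z X(2) by (auto simp: limitin_componentwise Z_def PiE_iff)
  have lim_Zk: "limitin (product_topology (\<lambda>_. euclidean) S) (\<lambda>n. (Z n)(k := X h n)) (z(k := h)) sequentially"
    using z X(2) \<open>k \<in> S\<close> by (auto simp: limitin_componentwise Z_def PiE_iff extensional_def)
  have "(\<lambda>n. f (Z n)) \<longlonglongrightarrow> f z" "(\<lambda>n. f ((Z n)(k := X h n))) \<longlonglongrightarrow> f (z(k := h))"
    using continuous_map_limit[OF cont lim_Z] continuous_map_limit[OF cont lim_Zk]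
    by (simp_all add: o_def)
  moreover have "f ((Z n)(k := X h n)) = f (Z n)" for n
    by (rule eq[OF Z X(1)])
  ultimately show ?thesis by (simp add: LIMSEQ_unique)
qed

text \<open>
  The null sets obtained so far depend on \<open>A\<close>, \<open>z\<close> and \<open>h\<close>. Countability of the cover and of a dense
  subset of \<open>H\<close> merges them into one, and continuity of \<open>t \<omega>\<close> then reaches all \<open>z\<close> and \<open>h\<close>.
\<close>
lemma inactive_reverse_lag_imp_inactive:
  assumes std: "standard_prob_space M" and mpt: "invertible_mpt M \<theta>"
    and "finite S" "k \<in> S" "finite F"
    and F: "0 \<in> F" "S \<subseteq> F" "\<And>s. s \<in> S \<Longrightarrow> s + k \<in> F"
    and free: "\<And>a b. a \<in> F \<Longrightarrow> b \<in> F \<Longrightarrow> a \<noteq> b \<Longrightarrow> AE \<omega> in M. iter M \<theta> a \<omega> \<noteq> iter M \<theta> b \<omega>"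
    and prox: "continuous_prox M T" and rep: "memory_representation M \<theta> S T t"
    and inact: "- k \<in> S \<Longrightarrow> lag_inactive M S t (- k)"
  shows "lag_inactive M S t k"
proof -
  interpret prob_space M using std by (simp add: standard_prob_space_def)
  obtain \<A> where \<A>: "countable \<A>" "\<A> \<subseteq> sets M" "AE \<omega> in M. \<omega> \<in> \<Union>\<A>"
    "\<And>A. A \<in> \<A> \<Longrightarrow> disjoint_translates M \<theta> F A"
    using countable_cover_disjoint_translates[OF std mpt \<open>finite F\<close> free] by blast
  obtain D :: "'b set" where D: "countable D" "\<And>X. open X \<Longrightarrow> X \<noteq> {} \<Longrightarrow> \<exists>d\<in>D. d \<in> X"
    using countable_dense_setE by blast
  have dense: "closure D = UNIV"
    using D(2) by (fastforce simp: closure_iff_nhds_not_empty)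
  have "AE \<omega> in M. \<forall>A\<in>\<A>. \<forall>z\<in>PiE S (\<lambda>_. D). \<forall>h\<in>D. \<omega> \<in> A \<longrightarrow> t \<omega> (z(k := h)) = t \<omega> z"
  proof (intro AE_ball_countable' \<A>(1) D(1) countable_PiE \<open>finite S\<close>)
    fix A z h assume "A \<in> \<A>" "z \<in> PiE S (\<lambda>_. D)" "h \<in> D"
    then show "AE \<omega> in M. \<omega> \<in> A \<longrightarrow> t \<omega> (z(k := h)) = t \<omega> z"
      using \<A>(2) by (intro representation_blind_at_constants[OF mpt rep prox \<open>finite S\<close> \<open>k \<in> S\<close> F _ \<A>(4) inact])
        (auto simp: PiE_iff)
  qed
  moreover have "AE \<omega> in M. continuous_map (product_topology (\<lambda>_. euclidean) S) euclidean (t \<omega>)"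
    using rep by (simp add: memory_representation_def)
  ultimately show ?thesis
    unfolding lag_inactive_def using \<A>(3)
  proof eventually_elim
    case (elim \<omega>)
    then have "\<And>z h. z \<in> PiE S (\<lambda>_. D) \<Longrightarrow> h \<in> D \<Longrightarrow> t \<omega> (z(k := h)) = t \<omega> z" by blast
    then show ?case
      using continuous_map_blind_from_dense[OF elim(2) dense \<open>k \<in> S\<close>] by blast
  qed
qed

theorem corollary6p4:
  fixes M :: "'a measure"
    and \<theta> :: "'a \<Rightarrow> 'a"
    and S F\<^sub>S :: "int set"
    and T :: "('a \<Rightarrow> 'h) \<Rightarrow> 'a \<Rightarrow> 'h::{real_inner, banach, second_countable_topology}"
    and t :: "'a \<Rightarrow> (int \<Rightarrow> 'h) \<Rightarrow> 'h"
  assumes "standard_prob_space M"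
    and "invertible_mpt M \<theta>"
    and "finite S"
    and "F\<^sub>S = {0} \<union> S \<union> {s + s' | s s'. s \<in> S \<and> s' \<in> S}"
    and "\<And>a b. a \<in> F\<^sub>S \<Longrightarrow> b \<in> F\<^sub>S \<Longrightarrow> a \<noteq> b \<Longrightarrow>
           AE \<omega> in M. iter M \<theta> a \<omega> \<noteq> iter M \<theta> b \<omega>"
    and "continuous_prox M T"
    and "memory_representation M \<theta> S T t"
  shows "Act M S t = uminus ` Act M S t \<and>
         (S \<inter> uminus ` S \<subseteq> {0} \<longrightarrow> (\<forall>k\<in>S. k \<noteq> 0 \<longrightarrow> lag_inactive M S t k))"
  proof -
  have inactive: "lag_inactive M S t k" if "k \<in> S" "- k \<notin> Act M S t" for k
  proof (rule inactive_reverse_lag_imp_inactive[OF assms(1-3) that(1) _ _ _ _ assms(5-7)])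
    have "F\<^sub>S = {0} \<union> S \<union> (\<lambda>(s, s'). s + s') ` (S \<times> S)"
      by (auto simp: assms(4))
    then show "finite F\<^sub>S" using assms(3) by simp
  qed (use that in \<open>auto simp: assms(4) Act_def\<close>)
  then have sym: "- k \<in> Act M S t" if "k \<in> Act M S t" for k
    using that by (auto simp: Act_def)
  have "Act M S t = uminus ` Act M S t"
  proof
    show "Act M S t \<subseteq> uminus ` Act M S t"
      using sym by (metis add.inverse_inverse image_eqI subsetI)
  qed (use sym in auto)
  moreover have "lag_inactive M S t k" if "S \<inter> uminus ` S \<subseteq> {0}" "k \<in> S" "k \<noteq> 0" for k
  proof (rule inactive)
    have "- k \<notin> S" using that by force
    then show "- k \<notin> Act M S t" by (simp add: Act_def)
  qed fact
  ultimately show ?thesis by blast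
qed

end
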